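(* For any $N\in\mathbb{N}$ and $M\in\mathbb{N}_0$, $$\phi_{2M,N+2M}(z;\tau)=(-1)^{1+\delta_e}\sum_{j=0}^{\frac{N-1-\delta_e}{2}+M}\frac{D_{2j+\delta_e+1}(\tau)}{(2j+\delta_e)!}\,\mathcal D_w^{2j+\delta_e}\left(F_N(z,u;\tau)\right)\Big|_{w=1},$$ where $D_k(\tau)$ denotes the Laurent coefficients of $\phi_{2M,N+2M}(z;\tau)$ at $z=0$.
   Context: Notation: $\tau\in\mathbb{H}$, $z,u\in\mathbb{C}$, $q=e^{2\pi i\tau}$, $\zeta=e^{2\pi iz}$, $w=e^{2\pi iu}$, with $q^a=e^{2\pi ia\tau}$, $\zeta^a=e^{2\pi iaz}$, $w^a=e^{2\pi iau}$; $(a)_\infty=\prod_{j\ge0}(1-aq^j)$; $\mathcal D_x=x\frac{\partial}{\partial x}$ (so $\mathcal D_w=\frac1{2\pi i}\frac{\partial}{\partial u}$, and $w=1$ means $u=0$). Let $\vartheta(z;\tau)=-i\zeta^{-1/2}q^{1/8}(q)_\infty(\zeta)_\infty(\zeta^{-1}q)_\infty$ and $\phi_{M,N}(z;\tau)=\vartheta(z+\frac12;\tau)^M/\vartheta(z;\tau)^N$. The Laurent coefficients of $\phi_{M,N}$ at $z=0$ (depending on $M,N$) are defined by $$\phi_{M,N}(z;\tau)=\frac{D_N(\tau)}{(2\pi iz)^N}+\frac{D_{N-2}(\tau)}{(2\pi iz)^{N-2}}+\dots+O(1).$$ Thus for $\phi_{2M,N+2M}$ the leading coefficient is $D_{N+2M}$.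 Set $\delta_e=0$ if $N$ is odd and $\delta_e=1$ if $N$ is even. The Appell–Lerch sum is $$F_N(z,u;\tau)=\zeta^{\frac N2}w^{\frac N2}\sum_{n\in\mathbb{Z}}\frac{(-w)^{Nn}q^{\frac N2n(n+1)}}{1-\zeta wq^n},\qquad (-w)^{Nn}=(-1)^{Nn}w^{Nn}.$$ The identity is one of meromorphic functions of $z$. *)

theory Defs
  imports "HOL-Complex_Analysis.Complex_Analysis"
begin

text \<open>
  \<open>e2pi a x\<close> is \<open>exp (2 \<pi> i a x)\<close>, which fixes the meaning of the fractional powers:
  \<open>q\<^sup>a = e2pi a \<tau>\<close>, \<open>\<zeta>\<^sup>a = e2pi a z\<close> and \<open>w\<^sup>a = e2pi a u\<close>.
\<close>

definition e2pi :: "complex \<Rightarrow> complex \<Rightarrow> complex" where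
  "e2pi a x = exp (2 * of_real pi * \<i> * a * x)"

definition qpoch_inf :: "complex \<Rightarrow> complex \<Rightarrow> complex" where
  "qpoch_inf a \<tau> = (\<Prod>j. 1 - a * e2pi 1 \<tau> ^ j)"

definition vartheta :: "complex \<Rightarrow> complex \<Rightarrow> complex" where
  "vartheta z \<tau> =
     - \<i> * e2pi (- 1 / 2) z * e2pi (1 / 8) \<tau>
     * qpoch_inf (e2pi 1 \<tau>) \<tau>
     * qpoch_inf (e2pi 1 z) \<tau>
     * qpoch_inf (e2pi (- 1) z * e2pi 1 \<tau>) \<tau>"

definition phi :: "nat \<Rightarrow> nat \<Rightarrow> complex \<Rightarrow> complex \<Rightarrow> complex" where
  "phi M N z \<tau> = vartheta (z + 1 / 2) \<tau> ^ M / vartheta z \<tau> ^ N"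

text \<open>
  \<open>laurent_D M N k \<tau>\<close> is the coefficient of \<open>1 / (2 \<pi> i z)\<^sup>k\<close> in the Laurent expansion
  of \<open>phi M N z \<tau>\<close> at \<open>z = 0\<close>; the factor converts from the expansion in powers of \<open>z\<close>.
\<close>

definition laurent_D :: "nat \<Rightarrow> nat \<Rightarrow> nat \<Rightarrow> complex \<Rightarrow> complex" where
  "laurent_D M N k \<tau> =
     (2 * of_real pi * \<i>) ^ k * fls_nth (laurent_expansion (\<lambda>z. phi M N z \<tau>) 0) (- int k)"

definition delta_e :: "nat \<Rightarrow> nat" where
  "delta_e N = (if even N then 1 else 0)"

definition appell_lerch :: "nat \<Rightarrow> complex \<Rightarrow> complex \<Rightarrow> complex \<Rightarrow> complex" where
  "appell_lerch N z u \<tau> =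
     e2pi (of_nat N / 2) z * e2pi (of_nat N / 2) u *
     (\<Sum>\<^sub>\<infinity>n::int.
        (- 1) powi (int N * n) * e2pi (of_int (int N * n)) u
        * e2pi (of_nat N / 2 * of_int (n * (n + 1))) \<tau>
        / (1 - e2pi 1 z * e2pi 1 u * e2pi (of_int n) \<tau>))"

text \<open>
  The operator \<open>w \<partial>/\<partial>w\<close>, acting on functions of \<open>u\<close> where \<open>w = exp (2 \<pi> i u)\<close>.
\<close>

definition D_w :: "(complex \<Rightarrow> complex) \<Rightarrow> complex \<Rightarrow> complex" where
  "D_w f = (\<lambda>u. deriv f u / (2 * of_real pi * \<i>))"

text \<open>
  The zeros of \<open>vartheta z \<tau>\<close>. An identity of meromorphic functions of \<open>z\<close> whose poles
  lie in this set is stated pointwise on its complement; there \<open>u = 0\<close> is a regular point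
  of \<open>appell_lerch N z u \<tau>\<close> as a function of \<open>u\<close>.
\<close>

definition period_lattice :: "complex \<Rightarrow> complex set" where
  "period_lattice \<tau> = {of_int m + of_int n * \<tau> | m n. True}"

end

theory Submission
  imports Defs
begin

text \<open>
  Fix \<open>z\<close> outside the period lattice and consider, as a function of \<open>u\<close>, the product
  \<open>h(u) = phi(u) * F(z, u)\<close> of the theta quotient with the Appell--Lerch sum. The sum
  \<open>F\<close> need not be quasi-periodic in \<open>z\<close>, but it is in \<open>u\<close>: the shift
  \<open>u \<mapsto> u + \<tau>\<close> only renumbers its terms, and the resulting automorphy factor is inverse to
  that of \<open>phi\<close> (\<open>phi_add_tau\<close>, \<open>appell_lerch_add_tau\<close>). So \<open>h\<close> is elliptic with periods
  \<open>1\<close> and \<open>\<tau>\<close>, and modulo the lattice it has at most two poles: \<open>u = 0\<close>, coming from \<open>phi\<close>,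
  and \<open>u = - z\<close>, coming from the single term of \<open>F\<close> whose denominator vanishes there.

  The residues of an elliptic function over a period cell sum to zero (\<open>elliptic_two_residues\<close>).
  At \<open>- z\<close> the pole is at most simple and the residue is a multiple of \<open>phi(- z) = (-1)^N phi(z)\<close>
  (\<open>residue_phi_appell_at_pole\<close>). At \<open>0\<close> the residue is the sum, over \<open>k\<close>, of the Laurent
  coefficient of \<open>phi\<close> at \<open>u^(-k)\<close> times the Taylor coefficient of \<open>F\<close> at \<open>u^(k-1)\<close>
  (\<open>residue_phi_appell_at_0\<close>); up to powers of \<open>2 \<pi> i\<close> these are the \<open>D_k\<close> and the
  \<open>(k-1)\<close>-st derivatives in the statement. Only indices \<open>k\<close> with the parity of \<open>N\<close> and
  \<open>k \<le> N + 2 M\<close> survive (\<open>has_laurent_expansion_phi\<close>), because \<open>phi\<close> has that parity and theta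
  vanishes to first order only. Solving for \<open>phi(z)\<close> gives the identity, with the sign
  \<open>(-1)^N = (-1)^(1 + \<delta>)\<close>.
\<close>

section \<open>The function \<open>e2pi\<close>\<close>

lemma e2pi_nonzero [simp]: "e2pi a x \<noteq> 0"
  by (simp add: e2pi_def)

lemma e2pi_0 [simp]: "e2pi 0 x = 1" "e2pi a 0 = 1"
  by (simp_all add: e2pi_def)

lemma e2pi_add_left: "e2pi (a + b) x = e2pi a x * e2pi b x"
  by (simp add: e2pi_def exp_add[symmetric] algebra_simps)

lemma e2pi_add_right: "e2pi a (x + y) = e2pi a x * e2pi a y"
  by (simp add: e2pi_def exp_add[symmetric] algebra_simps)

lemma e2pi_uminus_left: "e2pi (- a) x = inverse (e2pi a x)"
  by (simp add: e2pi_def exp_minus)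

lemma e2pi_uminus_right: "e2pi a (- x) = inverse (e2pi a x)"
  by (simp add: e2pi_def exp_minus)

lemma e2pi_eq_exp: "e2pi a x = e2pi 1 (a * x)"
  by (simp add: e2pi_def mult.assoc)

lemma e2pi_1_eq_1_iff: "e2pi 1 x = 1 \<longleftrightarrow> (\<exists>m. x = of_int m)"
proof -
  have "e2pi 1 x = 1 \<longleftrightarrow> (\<exists>m::int. Im x = 0 \<and> Re x = of_int m)"
    by (auto simp: e2pi_def exp_eq_1 field_simps)
  also have "\<dots> \<longleftrightarrow> (\<exists>m. x = of_int m)"
    by (auto simp: complex_eq_iff)
  finally show ?thesis .
qed

lemma e2pi_1_of_int [simp]: "e2pi 1 (of_int m) = 1"
  by (auto simp: e2pi_1_eq_1_iff)

lemma e2pi_of_int_1: "e2pi (of_int m) 1 = 1"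
  by (subst e2pi_eq_exp) simp

lemma e2pi_1_1 [simp]: "e2pi 1 1 = 1"
  using e2pi_1_of_int[of 1] by simp

lemma e2pi_half_1: "e2pi (1 / 2) 1 = - 1"
  by (simp add: e2pi_def)

lemma e2pi_power: "e2pi a x ^ n = e2pi (of_nat n * a) x"
  by (simp add: e2pi_def exp_of_nat_mult[symmetric] algebra_simps)

lemma norm_e2pi: "norm (e2pi a x) = exp (- 2 * pi * Im (a * x))"
  by (simp add: e2pi_def) (simp add: algebra_simps)

lemma holomorphic_on_e2pi [holomorphic_intros]:
  "f holomorphic_on A \<Longrightarrow> (\<lambda>u. e2pi a (f u)) holomorphic_on A"
  unfolding e2pi_def by (intro holomorphic_intros)

lemma e2pi_has_field_derivative:
  "(e2pi a has_field_derivative 2 * of_real pi * \<i> * a * e2pi a x) (at x)"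
  unfolding e2pi_def by (auto intro!: derivative_eq_intros)

lemma e2pi_field_differentiable: "e2pi a field_differentiable at x"
  using e2pi_has_field_derivative by (auto simp: field_differentiable_def)

section \<open>Contour integrals of periodic functions\<close>

lemma contour_integral_linepath_translate:
  "contour_integral (linepath (a + c) (b + c)) f = contour_integral (linepath a b) (\<lambda>u. f (u + c))"
proof -
  have "linepath (a + c) (b + c) = (+) c \<circ> linepath a b"
    by (rule ext) (simp add: linepath_def algebra_simps scaleR_add_right scaleR_diff_left)
  then show ?thesis
    by (simp add: contour_integral_translate)
qed

lemma periodic_of_int_shift:
  fixes f :: "complex \<Rightarrow> 'a"
  assumes "\<And>u. f (u + c) = f u"
  shows "f (u + of_int n * c) = f u"
proof (induction n rule: int_induct[where k = 0])
  case (step1 i)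
  then show ?case using assms[of "u + of_int i * c"] by (simp add: algebra_simps)
next
  case (step2 i)
  then show ?case using assms[of "u + of_int (i - 1) * c"] by (simp add: algebra_simps)
qed simp

text \<open>
  A segment of length one period can be slid along its line: the piece that leaves at one end
  is the translate by \<open>1\<close> of the piece that enters at the other end. Integer shifts do nothing,
  so only the fractional part of \<open>r\<close> matters, and then the two segments overlap.
\<close>

lemma contour_integral_full_period:
  fixes f :: "complex \<Rightarrow> complex" and r :: real
  assumes per: "\<And>u. f (u + 1) = f u"
    and cont: "continuous_on {u. Im u = Im a} f"
  shows "contour_integral (linepath (a + of_real r) (a + of_real r + 1)) f
       = contour_integral (linepath a (a + 1)) f"
proof -
  define t where "t = frac r"
  have t: "0 \<le> t" "t \<le> 1" unfolding t_def by (auto simp: frac_lt_1 less_imp_le)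
  have r: "of_real r = (of_real t + of_int \<lfloor>r\<rfloor> :: complex)"
    by (simp add: t_def frac_def)
  have cs: "continuous_on (closed_segment b (b + of_real s)) f" if "Im b = Im a" for b s
    by (rule continuous_on_subset[OF cont]) (use that in \<open>auto simp: closed_segment_same_Im\<close>)
  have fl: "f (u + of_int \<lfloor>r\<rfloor>) = f u" for u
    using periodic_of_int_shift[of f 1 u "\<lfloor>r\<rfloor>"] per by simp
  have "contour_integral (linepath (a + of_real r) (a + of_real r + 1)) f
      = contour_integral (linepath ((a + of_real t) + of_int \<lfloor>r\<rfloor>) ((a + of_real t + 1) + of_int \<lfloor>r\<rfloor>)) f"
    by (simp add: r add_ac)
  also have "\<dots> = contour_integral (linepath (a + of_real t) (a + of_real t + 1)) f"
    by (subst contour_integral_linepath_translate) (simp add: fl)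
  also have "\<dots> = contour_integral (linepath (a + of_real t) (a + 1)) f
                + contour_integral (linepath (a + 1) (a + of_real t + 1)) f"
    using cs[of "a + of_real t" 1] t
    by (intro contour_integral_split_linepath)
       (auto simp: closed_segment_same_Im closed_segment_eq_real_ivl)
  also have "contour_integral (linepath (a + 1) (a + of_real t + 1)) f
           = contour_integral (linepath a (a + of_real t)) f"
    by (subst contour_integral_linepath_translate) (simp add: per)
  also have "contour_integral (linepath (a + of_real t) (a + 1)) f
           + contour_integral (linepath a (a + of_real t)) f
           = contour_integral (linepath a (a + 1)) f"
    using cs[of a 1] t
    by (subst contour_integral_split_linepath[of a "a + 1" f "a + of_real t"])
       (auto simp: closed_segment_same_Im closed_segment_eq_real_ivl)
  finally show ?thesis .
qed

text \<open>
  The upright rectangle is not a period parallelogram unless \<open>\<tau>\<close> is purely imaginary, but its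
  edges still cancel: the vertical ones differ by the period \<open>1\<close>, and the top edge is, up to the
  period \<open>\<tau>\<close>, the bottom edge slid horizontally by \<open>- Re \<tau>\<close>. A rectangle is preferable because
  its winding numbers are known.
\<close>

lemma contour_integral_period_rectangle:
  fixes f :: "complex \<Rightarrow> complex"
  assumes per1: "\<And>u. f (u + 1) = f u" and per\<tau>: "\<And>u. f (u + \<tau>) = f u"
    and \<tau>: "Im \<tau> > 0"
    and hor: "continuous_on {u. Im u = Im a} f"
    and cont: "continuous_on (path_image (rectpath a (a + 1 + \<i> * of_real (Im \<tau>)))) f"
  shows "contour_integral (rectpath a (a + 1 + \<i> * of_real (Im \<tau>))) f = 0"
proof -
  define b where "b = a + \<i> * of_real (Im \<tau>)"
  have corners: "Complex (Re (a + 1 + \<i> * of_real (Im \<tau>))) (Im a) = a + 1"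
    "Complex (Re a) (Im (a + 1 + \<i> * of_real (Im \<tau>))) = b" 
    "a + 1 + \<i> * of_real (Im \<tau>) = b + 1"
    by (auto simp: complex_eq_iff b_def)
  have rect: "rectpath a (b + 1) =
      linepath a (a + 1) +++ linepath (a + 1) (b + 1) +++ linepath (b + 1) b +++ linepath b a"
    unfolding rectpath_def Let_def using corners by simp
  have c: "continuous_on (closed_segment a (a + 1)) f" "continuous_on (closed_segment (a + 1) (b + 1)) f"
      "continuous_on (closed_segment (b + 1) b) f" "continuous_on (closed_segment b a) f"
    using cont unfolding corners rect
    by (auto simp: path_image_join intro: continuous_on_subset)
  have left: "contour_integral (linepath (a + 1) (b + 1)) f = contour_integral (linepath a b) f"
    by (subst contour_integral_linepath_translate) (simp add: per1)
  have top: "contour_integral (linepath b (b + 1)) f = contour_integral (linepath a (a + 1)) f"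
  proof -
    have b: "b = (a + of_real (- Re \<tau>)) + \<tau>"
      by (simp add: b_def complex_eq_iff)
    have "contour_integral (linepath b (b + 1)) f =
        contour_integral (linepath ((a + of_real (- Re \<tau>)) + \<tau>) ((a + of_real (- Re \<tau>) + 1) + \<tau>)) f"
      by (simp add: b add_ac)
    also have "\<dots> = contour_integral (linepath (a + of_real (- Re \<tau>)) (a + of_real (- Re \<tau>) + 1)) f"
      by (subst contour_integral_linepath_translate) (simp add: per\<tau>)
    also have "\<dots> = contour_integral (linepath a (a + 1)) f"
      by (rule contour_integral_full_period[OF per1 hor])
    finally show ?thesis .
  qed
  have i: "f contour_integrable_on linepath a (a + 1)" "f contour_integrable_on linepath (a + 1) (b + 1)"
      "f contour_integrable_on linepath (b + 1) b" "f contour_integrable_on linepath b a"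
    using c by (auto intro: contour_integrable_continuous_linepath)
  have r: "contour_integral (linepath (b + 1) b) f = - contour_integral (linepath b (b + 1)) f"
    "contour_integral (linepath b a) f = - contour_integral (linepath a b) f"
    using contour_integral_reverse_linepath[of "b+1" b f] contour_integral_reverse_linepath[of b a f] c
    by simp_all
  show ?thesis
    unfolding corners rect using i left top r by simp
qed

section \<open>The period lattice\<close>

lemma period_lattice_add: "l \<in> period_lattice \<tau> \<Longrightarrow> l' \<in> period_lattice \<tau> \<Longrightarrow> l + l' \<in> period_lattice \<tau>"
  unfolding period_lattice_def
proof clarify
  fix m n m' n' :: int
  have "of_int m + of_int n * \<tau> + (of_int m' + of_int n' * \<tau>) = of_int (m + m') + of_int (n + n') * \<tau>"
    by (simp add: algebra_simps)
  then show "\<exists>k j. of_int m + of_int n * \<tau> + (of_int m' + of_int n' * \<tau>) = of_int k + of_int j * \<tau> \<and> True"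
    by blast
qed

lemma period_lattice_uminus: "l \<in> period_lattice \<tau> \<Longrightarrow> - l \<in> period_lattice \<tau>"
  unfolding period_lattice_def
proof clarify
  fix m n :: int
  have "- (of_int m + of_int n * \<tau>) = of_int (-m) + of_int (-n) * \<tau>"
    by (simp add: algebra_simps)
  then show "\<exists>k j. - (of_int m + of_int n * \<tau>) = of_int k + of_int j * \<tau> \<and> True"
    by blast
qed

lemma period_lattice_uminus_iff [simp]: "- l \<in> period_lattice \<tau> \<longleftrightarrow> l \<in> period_lattice \<tau>"
  using period_lattice_uminus[of l \<tau>] period_lattice_uminus[of "-l" \<tau>] by auto

lemma period_lattice_intI [intro]: "of_int m + of_int n * \<tau> \<in> period_lattice \<tau>"
  unfolding period_lattice_def by blast

lemma period_lattice_0 [simp]: "0 \<in> period_lattice \<tau>"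
  using period_lattice_intI[of 0 0 \<tau>] by simp

text \<open>
  Discreteness of the lattice in quantitative form: the imaginary part forces the coefficient of
  \<open>\<tau>\<close> to vanish, and then the real part forces the other coefficient to vanish.
\<close>

lemma period_lattice_eq_0:
  assumes "l \<in> period_lattice \<tau>" "\<bar>Re l\<bar> < 1" "\<bar>Im l\<bar> < Im \<tau>"
  shows "l = 0"
proof -
  obtain m n where l: "l = of_int m + of_int n * \<tau>"
    using assms(1) unfolding period_lattice_def by blast
  have \<tau>: "Im \<tau> > 0" using assms(3) by linarith
  have "\<bar>of_int n\<bar> * Im \<tau> < 1 * Im \<tau>" using assms(3) \<tau> by (simp add: l abs_mult)
  then have "\<bar>real_of_int n\<bar> < 1" using \<tau> by (simp only: mult_less_cancel_right_pos)
  then have n: "n = 0" by linarith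
  then have "\<bar>real_of_int m\<bar> < 1" using assms(2) by (simp add: l)
  then have "m = 0" by linarith
  with n l show ?thesis by simp
qed

lemma period_lattice_representative:
  assumes "Im \<tau> > 0"
  obtains l where "l \<in> period_lattice \<tau>" "0 \<le> Re (p + l)" "Re (p + l) < 1"
    "0 \<le> Im (p + l)" "Im (p + l) < Im \<tau>"
proof
  define n where "n = - \<lfloor>Im p / Im \<tau>\<rfloor>"
  define m where "m = - \<lfloor>Re (p + of_int n * \<tau>)\<rfloor>"
  define l where "l = of_int m + of_int n * \<tau>"
  show "l \<in> period_lattice \<tau>" unfolding l_def by blast
  have "Re (p + l) = frac (Re (p + of_int n * \<tau>))"
    by (simp add: l_def m_def frac_def)
  then show "0 \<le> Re (p + l)" "Re (p + l) < 1" by (auto simp: frac_lt_1)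
  have "Im (p + l) = frac (Im p / Im \<tau>) * Im \<tau>"
    using assms by (simp add: l_def n_def frac_def field_simps)
  then show "0 \<le> Im (p + l)" "Im (p + l) < Im \<tau>" using assms frac_lt_1[of "Im p / Im \<tau>"]
    by auto
qed

lemma closed_period_lattice:
  assumes "Im \<tau> > 0"
  shows "closed (period_lattice \<tau>)"
proof (rule discrete_imp_closed)
  show "0 < min 1 (Im \<tau>)" using assms by simp
  show "\<forall>x\<in>period_lattice \<tau>. \<forall>y\<in>period_lattice \<tau>. dist y x < min 1 (Im \<tau>) \<longrightarrow> y = x"
    unfolding dist_norm
  proof clarify
    fix x y assume xy: "x \<in> period_lattice \<tau>" "y \<in> period_lattice \<tau>" "norm (y - x) < min 1 (Im \<tau>)"
    have "y - x \<in> period_lattice \<tau>"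
      using period_lattice_add[of y \<tau> "- x"] xy by simp
    then have "y - x = 0"
      by (rule period_lattice_eq_0)
         (use xy(3) abs_Re_le_cmod[of "y - x"] abs_Im_le_cmod[of "y - x"] in linarith)+
    then show "y = x" by simp
  qed
qed

lemma open_shifted_period_lattice_complement:
  assumes "Im \<tau> > 0"
  shows "open {u. u + c \<notin> period_lattice \<tau>}"
proof -
  have "open ((\<lambda>u. u + c) -` (- period_lattice \<tau>))"
    by (intro open_vimage continuous_intros) (use closed_period_lattice[OF assms] in auto)
  then show ?thesis by (simp add: vimage_def)
qed

section \<open>The residues of an elliptic function\<close>

lemma elliptic_period_lattice_shift:
  assumes per1: "\<And>u. f (u + 1) = f u" and per\<tau>: "\<And>u. f (u + \<tau>) = f u" and "l \<in> period_lattice \<tau>"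
  shows "f (u + l) = f u"
proof -
  obtain m n where l: "l = of_int m + of_int n * \<tau>"
    using assms(3) unfolding period_lattice_def by blast
  have "f (u + l) = f ((u + of_int m * 1) + of_int n * \<tau>)" by (simp add: l add_ac)
  also have "\<dots> = f u"
    using periodic_of_int_shift[of f \<tau>, OF per\<tau>] periodic_of_int_shift[of f 1, OF per1] by simp
  finally show ?thesis .
qed

text \<open>
  Integrate over an upright rectangle of width \<open>1\<close> and height \<open>Im \<tau>\<close> that has exactly one
  representative of each pole class inside and none on its boundary. With the second pole moved to
  \<open>p'\<close> in the cell \<open>0 \<le> Re < 1\<close>, \<open>0 \<le> Im < Im \<tau>\<close>, the rectangle is placed so that in
  each coordinate its lower edge lies halfway between \<open>p'\<close> shifted down by one cell and \<open>0\<close>;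
  its upper edge then lies strictly above \<open>p'\<close> and strictly below the next copy of \<open>0\<close>.
\<close>

theorem elliptic_two_residues:
  fixes f :: "complex \<Rightarrow> complex"
  assumes \<tau>: "Im \<tau> > 0" and p: "p \<notin> period_lattice \<tau>"
    and holo: "f holomorphic_on {u. u \<notin> period_lattice \<tau> \<and> u - p \<notin> period_lattice \<tau>}"
    and per1: "\<And>u. f (u + 1) = f u" and per\<tau>: "\<And>u. f (u + \<tau>) = f u"
  shows "residue f 0 + residue f p = 0"
proof -
  obtain l where l: "l \<in> period_lattice \<tau>" and lb: "0 \<le> Re (p + l)" "Re (p + l) < 1"
    "0 \<le> Im (p + l)" "Im (p + l) < Im \<tau>"
    using period_lattice_representative[OF \<tau>, of p] by blast
  define p' where "p' = p + l"
  note lb = lb[folded p'_def]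
  have p'0: "p' \<notin> period_lattice \<tau>"
    using period_lattice_add[of p' \<tau> "-l"] p l unfolding p'_def by auto
  have res: "residue f p' = residue f p"
  proof -
    have "(\<lambda>x. f (p' + x)) = (\<lambda>x. f (p + x))"
      using elliptic_period_lattice_shift[of f, OF per1 per\<tau> l, of "p + x" for x]
      by (auto simp: p'_def add_ac)
    then show ?thesis by (subst (1 2) residue_shift_0) simp
  qed
  define x where "x = (Re p' - 1) / 2"
  define y where "y = (Im p' - Im \<tau>) / 2"
  \<comment> \<open>the margins \<open>d\<close> and \<open>e\<close> are half the distance from the rectangle to the next copy of a pole in that coordinate\<close>
  define d where "d = (1 - Re p') / 4"
  define e where "e = (Im \<tau> - Im p') / 4"
  have de: "d > 0" "e > 0" unfolding d_def e_def using lb by auto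
  define a where "a = Complex x y"
  define b where "b = a + 1 + \<i> * of_real (Im \<tau>)"
  define S where "S = box (Complex (x - d) (y - e)) (Complex (x + 1 + d) (y + Im \<tau> + e))"
  have poles: "u = 0 \<or> u = p'"
    if "u \<in> S" "u \<in> period_lattice \<tau> \<or> u - p' \<in> period_lattice \<tau>" for u
    using that(2)
  proof
    assume "u \<in> period_lattice \<tau>"
    then have "u = 0" by (rule period_lattice_eq_0)
      (use that(1) lb in \<open>auto simp: S_def in_box_complex_iff x_def y_def d_def e_def field_simps\<close>)
    then show ?thesis ..
  next
    assume "u - p' \<in> period_lattice \<tau>"
    then have "u - p' = 0" by (rule period_lattice_eq_0)
      (use that(1) lb in \<open>auto simp: S_def in_box_complex_iff x_def y_def d_def e_def field_simps\<close>)
    then show ?thesis by simp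
  qed
  have shiftp: "u - p' \<in> period_lattice \<tau> \<longleftrightarrow> u - p \<in> period_lattice \<tau>" for u
    using period_lattice_add[of "u - p'" \<tau> l] period_lattice_add[of "u - p" \<tau> "-l"] l
    by (auto simp: p'_def algebra_simps)
  have holS: "f holomorphic_on S - {0, p'}"
    by (rule holomorphic_on_subset[OF holo]) (use poles shiftp in blast)
  have xy: "x < 0" "x < Re p'" "0 < x + 1" "Re p' < x + 1"
    "y < 0" "y < Im p'" "0 < y + Im \<tau>" "Im p' < y + Im \<tau>"
    using lb \<tau> by (auto simp: x_def y_def field_simps)
  have img: "path_image (rectpath a b) \<subseteq> S - {0, p'}"
    using de xy \<tau>
    by (subst path_image_rectpath) (auto simp: a_def b_def S_def in_box_complex_iff)
  have box: "0 \<in> box a b" "p' \<in> box a b"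
    using xy by (auto simp: a_def b_def in_box_complex_iff)
  have cs: "cbox a b \<subseteq> S" 
    using de by (auto simp: a_def b_def S_def in_box_complex_iff in_cbox_complex_iff)
  \<comment> \<open>sliding the top edge leaves the rectangle, so the whole line through the bottom edge must be free of poles\<close>
  have hor: "continuous_on {u. Im u = Im a} f"
  proof (rule continuous_on_subset[OF holomorphic_on_imp_continuous_on[OF holo]], clarify)
    fix u assume u: "Im u = Im a"
    define k where "k = complex_of_int (\<lfloor>Re u - x\<rfloor>)"
    have k: "u - k \<in> path_image (rectpath a b)"
      using u \<tau> unfolding k_def
      by (subst path_image_rectpath) (auto simp: a_def b_def; linarith)+
    have kl: "k \<in> period_lattice \<tau>" using period_lattice_intI[of "\<lfloor>Re u - x\<rfloor>" 0 \<tau>] by (simp add: k_def)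
    show "u \<notin> period_lattice \<tau> \<and> u - p \<notin> period_lattice \<tau>"
      using k img poles[of "u - k"] period_lattice_add[of u \<tau> "-k"]
        period_lattice_add[of "u - p'" \<tau> "-k"] kl shiftp[of u]
      by (auto simp: algebra_simps)
  qed
  have "contour_integral (rectpath a b) f =
      2 * pi * \<i> * (\<Sum>q\<in>{0, p'}. winding_number (rectpath a b) q * residue f q)"
  proof (rule Residue_theorem[of S])
    show "open S" "connected S" by (auto simp: S_def intro: convex_connected)
    show "\<forall>z. z \<notin> S \<longrightarrow> winding_number (rectpath a b) z = 0"
      using cs \<tau> by (intro allI impI winding_number_rectpath_outside) (auto simp: b_def)
  qed (use holS img in auto)
  also have "(\<Sum>q\<in>{0, p'}. winding_number (rectpath a b) q * residue f q) = residue f 0 + residue f p'"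
  proof -
    have "p' \<noteq> 0" using p'0 by auto
    then show ?thesis using box by (simp add: winding_number_rectpath)
  qed
  also have "contour_integral (rectpath a b) f = 0"
    unfolding b_def
    by (rule contour_integral_period_rectangle[OF per1 per\<tau> \<tau> hor])
       (rule continuous_on_subset[OF holomorphic_on_imp_continuous_on[OF holS]], use img in \<open>simp add: b_def\<close>)
  finally show ?thesis by (simp add: res)
qed

section \<open>The theta function\<close>

lemma norm_q_less_1: "Im \<tau> > 0 \<Longrightarrow> norm (e2pi 1 \<tau>) < 1"
  by (simp add: norm_e2pi)

lemma qpoch_inf_convergent:
  assumes "Im \<tau> > 0"
  shows "convergent_prod (\<lambda>j. 1 - a * e2pi 1 \<tau> ^ j)"
proof -
  have "summable (\<lambda>j. norm a * norm (e2pi 1 \<tau>) ^ j)"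
    by (intro summable_mult summable_geometric) (use norm_q_less_1[OF assms] in simp)
  then have "summable (\<lambda>j. norm ((1 - a * e2pi 1 \<tau> ^ j) - 1))"
    by (simp add: norm_mult norm_power)
  then show ?thesis
    by (intro abs_convergent_prod_imp_convergent_prod summable_imp_abs_convergent_prod)
qed

lemma qpoch_inf_nonzero:
  assumes "Im \<tau> > 0" "\<And>j. a * e2pi 1 \<tau> ^ j \<noteq> 1"
  shows "qpoch_inf a \<tau> \<noteq> 0"
  unfolding qpoch_inf_def
  by (rule prodinf_nonzero[OF qpoch_inf_convergent[OF assms(1)]]) (use assms(2) in auto)

text \<open>
  The recurrence behind the oddness of theta and its behaviour under the shift by \<open>\<tau>\<close>. It also holds for
  \<open>a = 1\<close>, where splitting off the vanishing first factor is still legitimate.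
\<close>

lemma qpoch_inf_rec:
  assumes "Im \<tau> > 0"
  shows "qpoch_inf a \<tau> = (1 - a) * qpoch_inf (a * e2pi 1 \<tau>) \<tau>"
proof -
  have "(\<lambda>j. 1 - a * e2pi 1 \<tau> ^ j) has_prod
      ((\<Prod>k<1. 1 - a * e2pi 1 \<tau> ^ k) * (\<Prod>k. 1 - a * e2pi 1 \<tau> ^ (k + 1)))"
    by (rule has_prod_ignore_initial_segment'[OF qpoch_inf_convergent[OF assms]])
  then have "qpoch_inf a \<tau> = (\<Prod>k<1. 1 - a * e2pi 1 \<tau> ^ k) * (\<Prod>k. 1 - a * e2pi 1 \<tau> ^ (k + 1))"
    unfolding qpoch_inf_def by (rule has_prod_unique[symmetric])
  then show ?thesis
    unfolding qpoch_inf_def by (simp add: mult_ac)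
qed

text \<open>
  The partial products converge uniformly on every closed unit disc, by comparison with the
  geometric series in \<open>q\<close>.
\<close>

lemma qpoch_inf_entire:
  assumes "Im \<tau> > 0"
  shows "(\<lambda>a. qpoch_inf a \<tau>) holomorphic_on UNIV"
proof (rule holomorphic_uniform_sequence)
  show "(\<lambda>a. \<Prod>j<n. 1 - a * e2pi 1 \<tau> ^ j) holomorphic_on UNIV" for n
    by (intro holomorphic_intros)
  fix x :: complex
  define R where "R = norm x + 1"
  have "uniformly_convergent_on (cball x 1) (\<lambda>n a. \<Prod>j<n. 1 - a * e2pi 1 \<tau> ^ j)"
  proof (rule uniformly_convergent_on_prod')
    show "continuous_on (cball x 1) (\<lambda>a. 1 - a * e2pi 1 \<tau> ^ n)" for n
      by (intro continuous_intros)
    show "uniformly_convergent_on (cball x 1) (\<lambda>N a. \<Sum>n<N. norm ((1 - a * e2pi 1 \<tau> ^ n) - 1))"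
    proof (rule Weierstrass_m_test')
      show "summable (\<lambda>j. R * norm (e2pi 1 \<tau>) ^ j)"
        by (intro summable_mult summable_geometric) (use norm_q_less_1[OF assms] in simp)
      show "norm (norm ((1 - a * e2pi 1 \<tau> ^ n) - 1)) \<le> R * norm (e2pi 1 \<tau>) ^ n"
        if "a \<in> cball x 1" for n a
      proof -
        have "norm a \<le> R"
          using that norm_triangle_ineq2[of a x] by (simp add: R_def dist_norm norm_minus_commute)
        then show ?thesis by (simp add: norm_mult norm_power mult_right_mono)
      qed
    qed
  qed auto
  then obtain l where l: "uniform_limit (cball x 1) (\<lambda>n a. \<Prod>j<n. 1 - a * e2pi 1 \<tau> ^ j) l sequentially"
    by (auto simp: uniformly_convergent_on_def)
  have "l a = qpoch_inf a \<tau>" if "a \<in> cball x 1" for a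
  proof (rule LIMSEQ_unique)
    show "(\<lambda>n. \<Prod>j<n. 1 - a * e2pi 1 \<tau> ^ j) \<longlonglongrightarrow> l a"
      using tendsto_uniform_limitI[OF l that] .
    show "(\<lambda>n. \<Prod>j<n. 1 - a * e2pi 1 \<tau> ^ j) \<longlonglongrightarrow> qpoch_inf a \<tau>"
      using convergent_prod_LIMSEQ[OF qpoch_inf_convergent[OF assms, of a]]
      unfolding qpoch_inf_def LIMSEQ_lessThan_iff_atMost[symmetric] .
  qed
  with l have "uniform_limit (cball x 1) (\<lambda>n a. \<Prod>j<n. 1 - a * e2pi 1 \<tau> ^ j) (\<lambda>a. qpoch_inf a \<tau>) sequentially"
    by (auto elim!: uniform_limit_cong'[THEN iffD1, rotated -1])
  then show "\<exists>d>0. cball x d \<subseteq> UNIV \<and>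
      uniform_limit (cball x d) (\<lambda>n a. \<Prod>j<n. 1 - a * e2pi 1 \<tau> ^ j) (\<lambda>a. qpoch_inf a \<tau>) sequentially"
    by (intro exI[of _ 1]) auto
qed auto

lemma holomorphic_on_qpoch_inf [holomorphic_intros]:
  assumes "Im \<tau> > 0" "f holomorphic_on A"
  shows "(\<lambda>u. qpoch_inf (f u) \<tau>) holomorphic_on A"
  using holomorphic_on_compose_gen[OF assms(2) qpoch_inf_entire[OF assms(1)]]
  by (simp add: o_def)

lemma holomorphic_on_vartheta [holomorphic_intros]:
  assumes "Im \<tau> > 0" "f holomorphic_on A"
  shows "(\<lambda>u. vartheta (f u) \<tau>) holomorphic_on A"
  unfolding vartheta_def by (intro holomorphic_intros assms)

text \<open>
  Theta without its factor \<open>1 - \<zeta>\<close>: of the zeros of theta it omits the integers, in particular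
  \<open>0\<close>, which makes the order of vanishing at \<open>0\<close> visible.
\<close>

definition theta_cofactor :: "complex \<Rightarrow> complex \<Rightarrow> complex" where
  "theta_cofactor z \<tau> = - \<i> * e2pi (- 1 / 2) z * e2pi (1 / 8) \<tau> * qpoch_inf (e2pi 1 \<tau>) \<tau>
     * qpoch_inf (e2pi 1 z * e2pi 1 \<tau>) \<tau> * qpoch_inf (e2pi (- 1) z * e2pi 1 \<tau>) \<tau>"

lemma vartheta_factor:
  "Im \<tau> > 0 \<Longrightarrow> vartheta z \<tau> = (1 - e2pi 1 z) * theta_cofactor z \<tau>"
  unfolding vartheta_def theta_cofactor_def by (subst qpoch_inf_rec[of \<tau> "e2pi 1 z"]) auto

lemma e2pi_half_sq: "e2pi (1 / 2) z * e2pi (1 / 2) z = e2pi 1 z"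
  by (simp add: e2pi_add_left[symmetric])

lemma vartheta_uminus:
  assumes "Im \<tau> > 0"
  shows "vartheta (- z) \<tau> = - vartheta z \<tau>"
proof -
  have "e2pi (1 / 2) z * (1 - inverse (e2pi 1 z)) = - (inverse (e2pi (1 / 2) z) * (1 - e2pi 1 z))"
    unfolding e2pi_half_sq[symmetric] by (simp add: field_simps)
  then have key: "e2pi (- 1 / 2) (- z) * (1 - e2pi 1 (- z)) = - (e2pi (- 1 / 2) z * (1 - e2pi 1 z))"
    by (simp add: e2pi_uminus_left e2pi_uminus_right)
  have swap: "e2pi 1 (- z) = e2pi (- 1) z" "e2pi (- 1) (- z) = e2pi 1 z"
    by (simp_all add: e2pi_uminus_left e2pi_uminus_right)
  have alg: "t * (- \<i> * s * a * b * P * Q) = - (t' * (- \<i> * s' * a * b * Q * P))"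
    if "s * t = - (s' * t')" for s t s' t' a b P Q :: complex
  proof -
    have "t * (- \<i> * s * a * b * P * Q) = (s * t) * (- \<i> * a * b * P * Q)"
      by (simp only: mult_ac)
    then show ?thesis unfolding that by (simp add: mult_ac)
  qed
  show ?thesis
    using alg[OF key] unfolding vartheta_factor[OF assms] theta_cofactor_def swap .
qed

lemma vartheta_add_1: "vartheta (z + 1) \<tau> = - vartheta z \<tau>"
  unfolding vartheta_def
  by (simp add: e2pi_add_right e2pi_uminus_left e2pi_half_1)

text \<open>
  Under \<open>\<zeta> \<mapsto> \<zeta> q\<close> the product over \<open>\<zeta>\<close> loses its first factor and the product over
  \<open>\<zeta>\<inverse> q\<close> gains the factor \<open>1 - \<zeta>\<inverse> = - \<zeta>\<inverse> (1 - \<zeta>)\<close>, so the net effect is a monomial.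
\<close>

lemma vartheta_add_tau:
  assumes "Im \<tau> > 0"
  shows "vartheta (z + \<tau>) \<tau> = - e2pi (- 1 / 2) \<tau> * e2pi (- 1) z * vartheta z \<tau>"
proof -
  have "vartheta (z + \<tau>) \<tau> = - \<i> * e2pi (- 1 / 2) z * e2pi (- 1 / 2) \<tau> * e2pi (1 / 8) \<tau>
     * qpoch_inf (e2pi 1 \<tau>) \<tau> * qpoch_inf (e2pi 1 z * e2pi 1 \<tau>) \<tau> * qpoch_inf (e2pi (- 1) z) \<tau>"
    unfolding vartheta_def by (simp add: e2pi_add_right e2pi_uminus_left mult.assoc)
  also have "qpoch_inf (e2pi (- 1) z) \<tau> = (1 - e2pi (- 1) z) * qpoch_inf (e2pi (- 1) z * e2pi 1 \<tau>) \<tau>"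
    by (rule qpoch_inf_rec[OF assms])
  also have "1 - e2pi (- 1) z = - e2pi (- 1) z * (1 - e2pi 1 z)"
    by (simp add: e2pi_uminus_left field_simps)
  finally show ?thesis
    unfolding vartheta_factor[OF assms, of z] theta_cofactor_def by (simp add: mult_ac)
qed

lemma theta_qpoch_nonzero:
  assumes "Im \<tau> > 0" "\<And>m. z + of_nat n * \<tau> \<noteq> of_int m"
  shows "e2pi 1 z * e2pi 1 \<tau> ^ n \<noteq> 1"
proof -
  have "e2pi 1 z * e2pi 1 \<tau> ^ n = e2pi 1 (z + of_nat n * \<tau>)"
    by (simp add: e2pi_add_right e2pi_power) (subst e2pi_eq_exp, simp)
  with assms(2) show ?thesis by (auto simp: e2pi_1_eq_1_iff)
qed

lemma theta_cofactor_nonzero: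
  assumes "Im \<tau> > 0" "z = 0 \<or> z \<notin> period_lattice \<tau>"
  shows "theta_cofactor z \<tau> \<noteq> 0"
proof -
  have *: "x + of_nat n * \<tau> \<noteq> of_int m" if "n > 0" "x = 0 \<or> x \<notin> period_lattice \<tau>" for x m and n :: nat
  proof
    assume eq: "x + of_nat n * \<tau> = of_int m"
    then have "x = of_int m + of_int (- int n) * \<tau>"
      by (simp add: algebra_simps)
    then have "x \<in> period_lattice \<tau>" unfolding period_lattice_def by blast
    with that have "x = 0" by auto
    with eq have "Im (of_nat n * \<tau>) = 0" by simp
    with assms(1) that(1) show False by simp
  qed
  have **: "qpoch_inf (e2pi 1 x * e2pi 1 \<tau>) \<tau> \<noteq> 0" if "x = 0 \<or> x \<notin> period_lattice \<tau>" for x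
  proof (rule qpoch_inf_nonzero[OF assms(1)])
    fix j
    show "e2pi 1 x * e2pi 1 \<tau> * e2pi 1 \<tau> ^ j \<noteq> 1"
      using theta_qpoch_nonzero[OF assms(1), of x "Suc j"] *[OF _ that, of "Suc j"]
      by (simp add: mult.assoc)
  qed
  have "e2pi (- 1) z = e2pi 1 (- z)" by (simp add: e2pi_uminus_left e2pi_uminus_right)
  then show ?thesis
    using **[of 0] **[of z] **[of "- z"] assms(2) unfolding theta_cofactor_def by auto
qed

lemma vartheta_nonzero:
  assumes "Im \<tau> > 0" "z \<notin> period_lattice \<tau>"
  shows "vartheta z \<tau> \<noteq> 0"
proof -
  have "e2pi 1 z \<noteq> 1"
    using assms(2) period_lattice_intI[of _ 0 \<tau>] by (auto simp: e2pi_1_eq_1_iff)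
  then show ?thesis
    using theta_cofactor_nonzero[OF assms(1)] assms(2) by (simp add: vartheta_factor[OF assms(1)])
qed

lemma vartheta_0: "Im \<tau> > 0 \<Longrightarrow> vartheta 0 \<tau> = 0"
  by (simp add: vartheta_factor)

lemma deriv_vartheta_0_nonzero:
  assumes "Im \<tau> > 0"
  shows "deriv (\<lambda>z. vartheta z \<tau>) 0 \<noteq> 0"
proof -
  have "(\<lambda>z. theta_cofactor z \<tau>) holomorphic_on UNIV"
    unfolding theta_cofactor_def by (intro holomorphic_intros assms)
  then have "((\<lambda>z. theta_cofactor z \<tau>) has_field_derivative deriv (\<lambda>z. theta_cofactor z \<tau>) 0) (at 0)"
    using holomorphic_derivI by blast
  then have "((\<lambda>z. (1 - e2pi 1 z) * theta_cofactor z \<tau>) has_field_derivative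
      - (2 * of_real pi * \<i>) * theta_cofactor 0 \<tau>) (at 0)"
    by (auto intro!: derivative_eq_intros e2pi_has_field_derivative)
  then have "deriv (\<lambda>z. vartheta z \<tau>) 0 = - (2 * of_real pi * \<i>) * theta_cofactor 0 \<tau>"
    unfolding vartheta_factor[OF assms] by (rule DERIV_imp_deriv)
  then show ?thesis using theta_cofactor_nonzero[OF assms, of 0] by simp
qed

section \<open>The theta quotient\<close>

lemma neg_power_add_even:
  fixes x :: complex
  shows "(- x) ^ (N + 2 * M) = (- 1) ^ N * x ^ (N + 2 * M)"
  by (subst power_minus) (simp add: power_add)

lemma phi_add_1:
  "phi (2 * M) (N + 2 * M) (u + 1) \<tau> = (- 1) ^ N * phi (2 * M) (N + 2 * M) u \<tau>"
proof -
  have "phi (2 * M) (N + 2 * M) (u + 1) \<tau> =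
      (- vartheta (u + 1 / 2) \<tau>) ^ (2 * M) / (- vartheta u \<tau>) ^ (N + 2 * M)"
    using vartheta_add_1[of "u + 1 / 2" \<tau>] by (simp add: phi_def vartheta_add_1 add.assoc add.left_commute add.commute[of 1])
  also have "\<dots> = (- 1) ^ N * phi (2 * M) (N + 2 * M) u \<tau>"
    unfolding phi_def neg_power_add_even by (simp add: divide_simps)
  finally show ?thesis .
qed

text \<open>
  The half-period shift changes the sign of the automorphy factor of the numerator, which is
  invisible because its exponent \<open>2 M\<close> is even. The \<open>2 M\<close> numerator factors cancel against
  \<open>2 M\<close> of the denominator factors, and weight \<open>N\<close> remains.
\<close>

lemma phi_add_tau:
  assumes "Im \<tau> > 0"
  shows "phi (2 * M) (N + 2 * M) (u + \<tau>) \<tau> =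
    (- 1) ^ N * (e2pi (1 / 2) \<tau> * e2pi 1 u) ^ N * phi (2 * M) (N + 2 * M) u \<tau>"
proof -
  define c where "c = e2pi (1 / 2) \<tau> * e2pi 1 u"
  have c: "c \<noteq> 0" by (simp add: c_def)
  have "e2pi 1 (u + 1 / 2) = - e2pi 1 u"
    unfolding e2pi_add_right by (subst (2) e2pi_eq_exp) (simp add: e2pi_def)
  then have "vartheta (u + \<tau> + 1 / 2) \<tau> = inverse c * vartheta (u + 1 / 2) \<tau>"
    using vartheta_add_tau[OF assms, of "u + 1 / 2"]
    by (simp add: c_def e2pi_uminus_left add_ac)
  moreover have "vartheta (u + \<tau>) \<tau> = - inverse c * vartheta u \<tau>"
    using vartheta_add_tau[OF assms, of u] by (simp add: c_def e2pi_uminus_left)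
  ultimately have "phi (2 * M) (N + 2 * M) (u + \<tau>) \<tau> =
      (inverse c * vartheta (u + 1 / 2) \<tau>) ^ (2 * M) / (- inverse c * vartheta u \<tau>) ^ (N + 2 * M)"
    by (simp add: phi_def)
  also have "\<dots> = (- 1) ^ N * c ^ N * phi (2 * M) (N + 2 * M) u \<tau>"
    unfolding phi_def using c
    by (simp add: power_mult_distrib power_minus[of "inverse c * _"] power_minus[of "vartheta _ _ / c"] power_add divide_simps)
  finally show ?thesis by (simp add: c_def)
qed

lemma phi_uminus:
  assumes "Im \<tau> > 0"
  shows "phi (2 * M) (N + 2 * M) (- u) \<tau> = (- 1) ^ N * phi (2 * M) (N + 2 * M) u \<tau>"
proof -
  have "vartheta (- u + 1 / 2) \<tau> = - vartheta (- u - 1 / 2) \<tau>"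
    using vartheta_add_1[of "- u - 1 / 2" \<tau>] by (simp add: algebra_simps)
  also have "\<dots> = vartheta (u + 1 / 2) \<tau>"
    using vartheta_uminus[OF assms, of "u + 1 / 2"] by (simp add: algebra_simps)
  finally have "phi (2 * M) (N + 2 * M) (- u) \<tau> =
      vartheta (u + 1 / 2) \<tau> ^ (2 * M) / (- vartheta u \<tau>) ^ (N + 2 * M)"
    by (simp add: phi_def vartheta_uminus[OF assms])
  also have "\<dots> = (- 1) ^ N * phi (2 * M) (N + 2 * M) u \<tau>"
    unfolding phi_def neg_power_add_even by (simp add: divide_simps)
  finally show ?thesis .
qed

lemma holomorphic_on_phi:
  assumes "Im \<tau> > 0"
  shows "(\<lambda>u. phi (2 * M) (N + 2 * M) u \<tau>) holomorphic_on - period_lattice \<tau>"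
  unfolding phi_def
  by (intro holomorphic_intros assms) (use vartheta_nonzero[OF assms] in auto)

text \<open>
  The order of the pole is at most \<open>N + 2 M\<close> since theta has a simple zero at \<open>0\<close>. The parity
  of the coefficients comes from comparing the expansions of both sides of \<open>phi_uminus\<close>.
\<close>

lemma has_laurent_expansion_phi:
  assumes "Im \<tau> > 0"
  obtains L where "(\<lambda>u. phi (2 * M) (N + 2 * M) u \<tau>) has_laurent_expansion L"
    and "\<And>n. n < - int (N + 2 * M) \<Longrightarrow> fls_nth L n = 0"
    and "\<And>n. even n \<noteq> even N \<Longrightarrow> fls_nth L n = 0"
proof -
  define K where "K = N + 2 * M"
  define T where "T = fps_expansion (\<lambda>u. vartheta u \<tau>) 0"
  define A where "A = fps_expansion (\<lambda>u. vartheta (u + 1 / 2) \<tau>) 0"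
  define L where "L = fps_to_fls A ^ (2 * M) / fps_to_fls T ^ K"
  have "(\<lambda>u. vartheta u \<tau>) analytic_on UNIV" "(\<lambda>u. vartheta (u + 1 / 2) \<tau>) analytic_on UNIV"
    by (auto simp: analytic_on_open intro!: holomorphic_intros assms)
  then have T: "(\<lambda>u. vartheta u \<tau>) has_fps_expansion T" 
    and A: "(\<lambda>u. vartheta (u + 1 / 2) \<tau>) has_fps_expansion A"
    unfolding T_def A_def
    by (auto intro!: analytic_at_imp_has_fps_expansion_0 intro: analytic_on_subset)
  have exp: "(\<lambda>u. phi (2 * M) K u \<tau>) has_laurent_expansion L"
    unfolding phi_def L_def
    by (intro laurent_expansion_intros has_laurent_expansion_fps T A)
  have "fps_nth T 0 = 0" "fps_nth T (Suc 0) \<noteq> 0"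
    using vartheta_0[OF assms] deriv_vartheta_0_nonzero[OF assms]
    by (simp_all add: T_def fps_expansion_def)
  then have subT: "subdegree T = 1"
    by (intro subdegreeI) auto
  have sub: "fls_nth L n = 0" if "n < - int K" for n
  proof (cases "L = 0")
    case False
    then have "fls_subdegree (fps_to_fls A ^ (2 * M)) - fls_subdegree (fps_to_fls T ^ K) \<le> fls_subdegree L"
      unfolding L_def by (rule fls_divide_subdegree_ge)
    moreover have "0 \<le> fls_subdegree (fps_to_fls A ^ (2 * M))"
      by (simp add: fls_subdegree_pow fls_subdegree_fls_to_fps)
    moreover have "fls_subdegree (fps_to_fls T ^ K) = int K"
      by (simp add: fls_subdegree_pow fls_subdegree_fls_to_fps subT)
    ultimately have "- int K \<le> fls_subdegree L"
      by linarith
    with that show ?thesis by simp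
  qed simp
  have parity: "fls_nth L n = 0" if "even n \<noteq> even N" for n
  proof -
    have "((\<lambda>u. phi (2 * M) K u \<tau>) \<circ> (\<lambda>u. - 1 * u)) has_laurent_expansion
        fls_compose_fps L (fps_const (- 1) * fps_X)"
      by (intro has_laurent_expansion_compose exp has_laurent_expansion_fps fps_expansion_intros) auto
    moreover have "(\<lambda>u. phi (2 * M) K u \<tau>) \<circ> (\<lambda>u. - 1 * u) = (\<lambda>u. (- 1) ^ N * phi (2 * M) K u \<tau>)"
      unfolding K_def by (auto simp: phi_uminus[OF assms])
    moreover have "(\<lambda>u. (- 1) ^ N * phi (2 * M) K u \<tau>) has_laurent_expansion fls_const ((- 1) ^ N) * L"
      by (intro laurent_expansion_intros exp)
    ultimately have "fls_compose_fps L (fps_const (- 1) * fps_X) = fls_const ((- 1) ^ N) * L"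
      using has_laurent_expansion_unique by metis
    then have "fls_nth (fls_compose_fps L (fps_const (- 1) * fps_X)) n = fls_nth (fls_const ((- 1) ^ N) * L) n"
      by simp
    then have "fls_nth L n * (- 1) powi n = (- 1) ^ N * fls_nth L n"
      by (subst (asm) fls_nth_fls_compose_fps_linear) auto
    with that show ?thesis by (cases "even N") auto
  qed
  show ?thesis using that[OF exp[unfolded K_def] sub[unfolded K_def] parity] .
qed

section \<open>The Appell--Lerch sum\<close>

definition appell_term :: "nat \<Rightarrow> complex \<Rightarrow> complex \<Rightarrow> int \<Rightarrow> complex \<Rightarrow> complex" where
  "appell_term N z \<tau> n u =
     (- 1) powi (int N * n) * e2pi (of_int (int N * n)) u
     * e2pi (of_nat N / 2 * of_int (n * (n + 1))) \<tau>
     / (1 - e2pi 1 z * e2pi 1 u * e2pi (of_int n) \<tau>)"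

lemma appell_lerch_eq:
  "appell_lerch N z u \<tau> =
     e2pi (of_nat N / 2) z * e2pi (of_nat N / 2) u * (\<Sum>\<^sub>\<infinity>n. appell_term N z \<tau> n u)"
  unfolding appell_lerch_def appell_term_def ..

lemma appell_denominator: "e2pi 1 z * e2pi 1 u * e2pi (of_int n) \<tau> = e2pi 1 (z + u + of_int n * \<tau>)"
  by (simp add: e2pi_add_right e2pi_eq_exp[of "of_int n"])

lemma summable_exp_abs_int: "(\<lambda>n::int. exp (- real_of_int \<bar>n\<bar>)) summable_on UNIV"
proof -
  have g: "(\<lambda>n::nat. exp (- real n)) summable_on UNIV"
  proof (rule norm_summable_imp_summable_on)
    have "summable (\<lambda>n::nat. exp (- 1 :: real) ^ n)" by (rule summable_geometric) simp
    then show "summable (\<lambda>n::nat. norm (exp (- real n)))"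
      by (simp add: exp_of_nat_mult[symmetric])
  qed
  have "(\<lambda>n::int. exp (- real_of_int \<bar>n\<bar>)) summable_on range int"
    using g by (subst summable_on_reindex) (auto simp: o_def)
  moreover have "(\<lambda>n::int. exp (- real_of_int \<bar>n\<bar>)) summable_on range (\<lambda>n. - int n)"
    using g by (subst summable_on_reindex) (auto simp: o_def inj_on_def)
  moreover have "(UNIV :: int set) = range int \<union> range (\<lambda>n. - int n)"
    using int_cases2 by blast
  ultimately show ?thesis using summable_on_union by metis
qed

text \<open>
  For \<open>Im x \<ge> 1\<close> the exponential has modulus at most \<open>1 / 2\<close>, for \<open>Im x \<le> - 1\<close> at least
  \<open>2\<close>; in both cases the denominator of a term of the Appell--Lerch sum stays away from zero.
\<close>

lemma norm_one_minus_exp_ge: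
  assumes "1 \<le> \<bar>Im x\<bar>"
  shows "1 / 2 \<le> norm (1 - e2pi 1 x)"
proof -
  have e: "norm (e2pi 1 x) = exp (- (2 * pi * Im x))" by (simp add: norm_e2pi)
  have two: "2 \<le> exp (1::real)" using exp_ge_add_one_self[of "1::real"] by simp
  have tp: "1 \<le> 2 * pi" using pi_ge_two by linarith
  show ?thesis
  proof (cases "Im x \<ge> 0")
    case True
    then have "1 * 1 \<le> 2 * pi * Im x" using tp assms by (intro mult_mono) auto
    then have "norm (e2pi 1 x) \<le> exp (- 1)" unfolding e by simp
    also have "\<dots> \<le> 1 / 2" using two by (simp add: exp_minus field_simps)
    finally show ?thesis using norm_triangle_ineq2[of 1 "e2pi 1 x"] by simp
  next
    case False
    then have "1 * 1 \<le> 2 * pi * (- Im x)" using tp assms by (intro mult_mono) auto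
    then have "exp 1 \<le> norm (e2pi 1 x)" unfolding e by simp
    then show ?thesis using two norm_triangle_ineq3[of 1 "e2pi 1 x"] by simp
  qed
qed

text \<open>
  The Gaussian factor \<open>q^(N n (n + 1) / 2)\<close> beats the at most exponential growth of
  \<open>w^(N n)\<close>. Quantitatively, \<open>b k - c k^2 \<le> b^2 / (4 c)\<close> for all real \<open>k\<close>, and one extra
  summand \<open>k\<close> put into \<open>b k\<close> leaves the summable factor \<open>exp (- k)\<close> with \<open>k = |n|\<close>. The
  constant does not depend on \<open>u\<close>, as the M-test requires.
\<close>

lemma norm_appell_term_le:
  fixes T R :: real
  assumes "N \<ge> 1" "Im \<tau> > 0" "\<bar>Im u\<bar> \<le> R" "\<bar>Im z\<bar> + R + 1 \<le> \<bar>real_of_int n\<bar> * Im \<tau>"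
  shows "norm (appell_term N z \<tau> n u)
    \<le> 2 * exp (real N * ((2 * pi * R + pi * Im \<tau> + 1)\<^sup>2 / (4 * (pi * Im \<tau>)))) * exp (- real_of_int \<bar>n\<bar>)"
proof -
  define c where "c = pi * Im \<tau>"
  define b where "b = 2 * pi * R + c + 1"
  define k where "k = real_of_int \<bar>n\<bar>"
  have c: "c > 0" using assms(2) by (simp add: c_def)
  have k: "k \<ge> 0" "\<bar>real_of_int n\<bar> = k" "real_of_int n * real_of_int n = k * k"
    by (auto simp: k_def)
  have R: "R \<ge> 0" using assms(3) by linarith
  have "\<bar>real_of_int n\<bar> * Im \<tau> = \<bar>of_int n * Im \<tau>\<bar>" using assms(2) by (simp add: abs_mult)
  then have "1 \<le> \<bar>Im (z + u + of_int n * \<tau>)\<bar>" using assms(3,4) by simp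
  then have den: "1 / 2 \<le> norm (1 - e2pi 1 z * e2pi 1 u * e2pi (of_int n) \<tau>)"
    unfolding appell_denominator by (rule norm_one_minus_exp_ge)
  define X where "X = - (2 * pi * (real_of_int n * Im u)) - c * (real_of_int n * (real_of_int n + 1))"
  have num: "norm ((- 1) powi (int N * n) * e2pi (of_int (int N * n)) u
     * e2pi (of_nat N / 2 * of_int (n * (n + 1))) \<tau>) = exp (real N * X)"
    by (simp add: norm_mult norm_power_int norm_e2pi exp_add[symmetric] X_def c_def algebra_simps)
  have "\<bar>real_of_int n * Im u\<bar> \<le> k * R"
    unfolding abs_mult k(2) using assms(3) k(1) by (rule mult_left_mono)
  then have "2 * pi * (- (real_of_int n * Im u)) \<le> 2 * pi * (k * R)"
    by (intro mult_left_mono) auto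
  moreover have "- (c * (real_of_int n * (real_of_int n + 1))) \<le> c * k - c * (k * k)"
  proof -
    have "c * (- real_of_int n) \<le> c * k" using c by (intro mult_left_mono) (auto simp: k_def)
    then show ?thesis using k(3) by (simp add: algebra_simps)
  qed
  ultimately have "X \<le> b * k - c * (k * k) - k"
    unfolding X_def b_def by (simp add: algebra_simps)
  also have "b * k - c * (k * k) \<le> b\<^sup>2 / (4 * c)"
  proof -
    have "0 \<le> (b - 2 * c * k)\<^sup>2 / (4 * c)" using c by simp
    also have "\<dots> = b\<^sup>2 / (4 * c) - b * k + c * (k * k)"
      using c by (simp add: power2_eq_square field_simps)
    finally show ?thesis by simp
  qed
  finally have "real N * X \<le> real N * (b\<^sup>2 / (4 * c) - k)"
    by (intro mult_left_mono) auto
  also have "\<dots> \<le> real N * (b\<^sup>2 / (4 * c)) - k"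
    using mult_right_mono[of 1 "real N" k] assms(1) k(1) by (simp add: algebra_simps)
  finally have "exp (real N * X) \<le> exp (real N * (b\<^sup>2 / (4 * c))) * exp (- k)"
    by (simp add: exp_add[symmetric])
  have "norm (appell_term N z \<tau> n u) = exp (real N * X) / norm (1 - e2pi 1 z * e2pi 1 u * e2pi (of_int n) \<tau>)"
    unfolding appell_term_def norm_divide num ..
  also have "\<dots> \<le> exp (real N * X) / (1 / 2)"
    by (rule divide_left_mono[OF den]) (use den in auto)
  also have "\<dots> \<le> 2 * exp (real N * (b\<^sup>2 / (4 * c))) * exp (- k)"
    using \<open>exp (real N * X) \<le> _\<close> by simp
  finally show ?thesis by (simp add: b_def c_def k_def)
qed

text \<open>
  For \<open>u\<close> in a fixed disc all terms of large index are free of poles and uniformly dominated, so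
  the M-test applies to them.
\<close>

lemma appell_tail:
  assumes "N \<ge> 1" "Im \<tau> > 0"
    and A: "\<And>n. n \<in> A \<Longrightarrow> \<bar>Im z\<bar> + R + 1 \<le> \<bar>real_of_int n\<bar> * Im \<tau>"
  shows "(\<lambda>u. \<Sum>\<^sub>\<infinity>n\<in>A. appell_term N z \<tau> n u) holomorphic_on ball 0 R"
    and "u \<in> ball 0 R \<Longrightarrow> (\<lambda>n. appell_term N z \<tau> n u) summable_on A"
proof -
  define C where "C = 2 * exp (real N * ((2 * pi * R + pi * Im \<tau> + 1)\<^sup>2 / (4 * (pi * Im \<tau>))))"
  have Im_le: "\<bar>Im u\<bar> \<le> R" if "u \<in> cball 0 R" for u
    using that abs_Im_le_cmod[of u] by simp
  have bound: "norm (appell_term N z \<tau> n u) \<le> C * exp (- real_of_int \<bar>n\<bar>)"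
    if "n \<in> A" "u \<in> cball 0 R" for n u
    unfolding C_def by (rule norm_appell_term_le[OF assms(1,2) Im_le[OF that(2)] A[OF that(1)]])
  have sum: "(\<lambda>n. C * exp (- real_of_int \<bar>n\<bar>)) summable_on A"
    by (intro summable_on_cmult_right summable_on_subset[OF summable_exp_abs_int]) auto
  have hol: "appell_term N z \<tau> n holomorphic_on cball 0 R" if "n \<in> A" for n
    unfolding appell_term_def
  proof (intro holomorphic_intros)
    fix u :: complex assume "u \<in> cball 0 R"
    then have "1 \<le> \<bar>Im (z + u + of_int n * \<tau>)\<bar>"
      using A[OF that] Im_le[of u] assms(2) abs_mult[of "real_of_int n" "Im \<tau>"] by simp
    then show "1 - e2pi 1 z * e2pi 1 u * e2pi (of_int n) \<tau> \<noteq> 0"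
      unfolding appell_denominator using norm_one_minus_exp_ge by fastforce
  qed
  show "(\<lambda>u. \<Sum>\<^sub>\<infinity>n\<in>A. appell_term N z \<tau> n u) holomorphic_on ball 0 R"
  proof (rule holomorphic_uniform_limit)
    show "uniform_limit (cball 0 R) (\<lambda>X u. \<Sum>n\<in>X. appell_term N z \<tau> n u)
        (\<lambda>u. \<Sum>\<^sub>\<infinity>n\<in>A. appell_term N z \<tau> n u) (finite_subsets_at_top A)"
      by (rule Weierstrass_m_test_general[OF bound sum])
    show "\<forall>\<^sub>F X in finite_subsets_at_top A.
        continuous_on (cball 0 R) (\<lambda>u. \<Sum>n\<in>X. appell_term N z \<tau> n u) \<and>
        (\<lambda>u. \<Sum>n\<in>X. appell_term N z \<tau> n u) holomorphic_on ball 0 R"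
    proof (rule eventually_finite_subsets_at_top_weakI)
      fix X assume "finite X" "X \<subseteq> A"
      then have "(\<lambda>u. \<Sum>n\<in>X. appell_term N z \<tau> n u) holomorphic_on cball 0 R"
        using hol by (intro holomorphic_on_sum) auto
      then show "continuous_on (cball 0 R) (\<lambda>u. \<Sum>n\<in>X. appell_term N z \<tau> n u) \<and>
        (\<lambda>u. \<Sum>n\<in>X. appell_term N z \<tau> n u) holomorphic_on ball 0 R"
        using holomorphic_on_imp_continuous_on holomorphic_on_subset ball_subset_cball by blast
    qed
  qed auto
  assume "u \<in> ball 0 R"
  then show "(\<lambda>n. appell_term N z \<tau> n u) summable_on A"
    using bound by (intro abs_summable_summable[OF summable_on_comparison_test[OF sum]]) auto
qed

lemma finite_appell_head:
  assumes "Im \<tau> > 0"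
  shows "finite {n::int. \<bar>real_of_int n\<bar> * Im \<tau> < B}"
proof (rule finite_subset)
  show "{n::int. \<bar>real_of_int n\<bar> * Im \<tau> < B} \<subseteq> {- \<lceil>B / Im \<tau>\<rceil>..\<lceil>B / Im \<tau>\<rceil>}"
  proof clarify
    fix n :: int assume "\<bar>real_of_int n\<bar> * Im \<tau> < B"
    then have "\<bar>real_of_int n\<bar> < B / Im \<tau>" using assms by (simp add: field_simps)
    then show "n \<in> {- \<lceil>B / Im \<tau>\<rceil>..\<lceil>B / Im \<tau>\<rceil>}" by (auto; linarith)
  qed
qed simp

text \<open>
  Near a given \<open>u\<close> the sum is a finite head plus a holomorphic tail. An arbitrary index set
  \<open>A\<close> is allowed because at a pole the sum without the offending term is needed.
\<close>

lemma appell_sum: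
  assumes "N \<ge> 1" "Im \<tau> > 0"
  shows "(\<lambda>n. appell_term N z \<tau> n u) summable_on A"
    and "(\<And>n. n \<in> A \<Longrightarrow> z + u + of_int n * \<tau> \<notin> \<int>) \<Longrightarrow>
      (\<lambda>u. \<Sum>\<^sub>\<infinity>n\<in>A. appell_term N z \<tau> n u) field_differentiable at u"
proof -
  define R where "R = norm u + 1"
  define B where "B = {n. \<bar>real_of_int n\<bar> * Im \<tau> < \<bar>Im z\<bar> + R + 1} \<inter> A"
  have u: "u \<in> ball 0 R" by (simp add: R_def)
  have B: "finite B" "B \<subseteq> A" unfolding B_def using finite_appell_head[OF assms(2)] by auto
  have AB: "\<bar>Im z\<bar> + R + 1 \<le> \<bar>real_of_int n\<bar> * Im \<tau>" if "n \<in> A - B" for n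
    using that by (auto simp: B_def)
  note tail = appell_tail[where A = "A - B", OF assms AB]
  have s: "(\<lambda>n. appell_term N z \<tau> n v) summable_on A" if "v \<in> ball 0 R" for v
    using summable_on_Un_disjoint[OF summable_on_finite[OF B(1)] tail(2)[OF _ that]] B(2)
    by (simp add: Un_absorb1)
  show "(\<lambda>n. appell_term N z \<tau> n u) summable_on A" by (rule s[OF u])
  assume *: "\<And>n. n \<in> A \<Longrightarrow> z + u + of_int n * \<tau> \<notin> \<int>"
  have split: "(\<Sum>\<^sub>\<infinity>n\<in>A. appell_term N z \<tau> n v) =
      (\<Sum>n\<in>B. appell_term N z \<tau> n v) + (\<Sum>\<^sub>\<infinity>n\<in>A - B. appell_term N z \<tau> n v)"
    if "v \<in> ball 0 R" for v
    using infsum_Un_disjoint[OF summable_on_finite[OF B(1)] tail(2)[OF _ that]] B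
    by (simp add: Un_absorb1)
  have "appell_term N z \<tau> n field_differentiable at u" if "n \<in> B" for n
  proof -
    have "e2pi 1 z * e2pi 1 u * e2pi (of_int n) \<tau> \<noteq> 1"
      unfolding appell_denominator e2pi_1_eq_1_iff using *[of n] that B(2) by (auto simp: Ints_def)
    then show ?thesis
      unfolding appell_term_def by (intro derivative_intros e2pi_field_differentiable) auto
  qed
  then have "(\<lambda>v. \<Sum>n\<in>B. appell_term N z \<tau> n v) field_differentiable at u"
    by (intro field_differentiable_sum) auto
  moreover have "(\<lambda>v. \<Sum>\<^sub>\<infinity>n\<in>A - B. appell_term N z \<tau> n v) field_differentiable at u"
    using tail(1) u by (simp add: holomorphic_on_open field_differentiable_def)
  ultimately obtain f' where "((\<lambda>v. (\<Sum>n\<in>B. appell_term N z \<tau> n v) +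
      (\<Sum>\<^sub>\<infinity>n\<in>A - B. appell_term N z \<tau> n v)) has_field_derivative f') (at u)"
    using field_differentiable_add field_differentiable_def by blast
  then have "((\<lambda>u. \<Sum>\<^sub>\<infinity>n\<in>A. appell_term N z \<tau> n u) has_field_derivative f') (at u)"
    by (rule has_field_derivative_transform_within_open[OF _ open_ball u]) (use split in simp)
  then show "(\<lambda>u. \<Sum>\<^sub>\<infinity>n\<in>A. appell_term N z \<tau> n u) field_differentiable at u"
    by (auto simp: field_differentiable_def)
qed

lemma holomorphic_on_appell_lerch:
  assumes "N \<ge> 1" "Im \<tau> > 0"
  shows "(\<lambda>u. appell_lerch N z u \<tau>) holomorphic_on {u. u + z \<notin> period_lattice \<tau>}"
  unfolding appell_lerch_eq
proof (intro holomorphic_intros)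
  show "(\<lambda>u. \<Sum>\<^sub>\<infinity>n. appell_term N z \<tau> n u) holomorphic_on {u. u + z \<notin> period_lattice \<tau>}"
    unfolding holomorphic_on_def
  proof (intro ballI, rule field_differentiable_at_within, rule appell_sum(2)[OF assms])
    fix u n assume u: "u \<in> {u. u + z \<notin> period_lattice \<tau>}"
    show "z + u + of_int n * \<tau> \<notin> \<int>"
    proof
      assume "z + u + of_int n * \<tau> \<in> \<int>"
      then obtain m where "z + u + of_int n * \<tau> = of_int m" by (auto elim: Ints_cases)
      then have "u + z = of_int m + of_int (- n) * \<tau>" by (simp add: algebra_simps)
      then have "u + z \<in> period_lattice \<tau>" unfolding period_lattice_def by blast
      with u show False by simp
    qed
  qed
qed

lemma appell_lerch_add_1: "appell_lerch N z (u + 1) \<tau> = (- 1) ^ N * appell_lerch N z u \<tau>"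
proof -
  have "appell_term N z \<tau> n (u + 1) = appell_term N z \<tau> n u" for n
    unfolding appell_term_def e2pi_add_right e2pi_of_int_1 by simp
  moreover have "e2pi (of_nat N / 2) 1 = (- 1) ^ N"
    using e2pi_power[of "1 / 2" 1 N] by (simp add: e2pi_half_1)
  ultimately show ?thesis
    by (simp add: appell_lerch_eq e2pi_add_right)
qed

text \<open>
  Completing the exponents: \<open>(n + 1) (n + 2) / 2 = n (n + 1) / 2 + (n + 1)\<close>, so the factor
  \<open>q^(N n)\<close> produced by the shift turns the term of index \<open>n\<close> into a multiple of the term of
  index \<open>n + 1\<close>, and this multiple does not depend on \<open>n\<close>.
\<close>

lemma appell_term_add_tau:
  "appell_term N z \<tau> n (u + \<tau>) =
     (- 1) ^ N * inverse (e2pi (of_nat N) (u + \<tau>)) * appell_term N z \<tau> (n + 1) u"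
proof -
  have den: "e2pi 1 z * e2pi 1 (u + \<tau>) * e2pi (of_int n) \<tau> = e2pi 1 z * e2pi 1 u * e2pi (of_int (n + 1)) \<tau>"
    unfolding appell_denominator by (simp add: algebra_simps)
  have sign: "(- 1 :: complex) powi (int N * (n + 1)) = (- 1) ^ N * (- 1) powi (int N * n)"
    by (simp add: distrib_left power_int_add)
  have "(of_int (int N * n) :: complex) * (u + \<tau>) + of_nat N / 2 * of_int (n * (n + 1)) * \<tau> =
      - (of_nat N * (u + \<tau>)) + (of_int (int N * (n + 1)) * u + of_nat N / 2 * of_int ((n + 1) * (n + 1 + 1)) * \<tau>)"
    by (simp add: algebra_simps)
  then have "e2pi 1 (of_int (int N * n) * (u + \<tau>) + of_nat N / 2 * of_int (n * (n + 1)) * \<tau>) =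
      e2pi 1 (- (of_nat N * (u + \<tau>)) + (of_int (int N * (n + 1)) * u + of_nat N / 2 * of_int ((n + 1) * (n + 1 + 1)) * \<tau>))"
    by (rule arg_cong)
  then have num: "e2pi (of_int (int N * n)) (u + \<tau>) * e2pi (of_nat N / 2 * of_int (n * (n + 1))) \<tau> =
      inverse (e2pi (of_nat N) (u + \<tau>)) *
      (e2pi (of_int (int N * (n + 1))) u * e2pi (of_nat N / 2 * of_int ((n + 1) * (n + 1 + 1))) \<tau>)"
    unfolding e2pi_add_right[of 1] e2pi_uminus_right e2pi_eq_exp[symmetric] .
  have alg: "s * e1 * e2 / d = (- 1) ^ N * i * (((- 1) ^ N * s) * f1 * f2 / d)"
    if "e1 * e2 = i * (f1 * f2)" for s e1 e2 i f1 f2 d :: complex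
  proof -
    have "s * e1 * e2 / d = s * (i * (f1 * f2)) / d"
      unfolding that[symmetric] by (simp only: mult.assoc)
    then show ?thesis by (cases "even N") (simp_all add: mult_ac)
  qed
  show ?thesis
    unfolding appell_term_def den sign by (rule alg[OF num])
qed

lemma appell_lerch_add_tau:
  "appell_lerch N z (u + \<tau>) \<tau> =
     (- 1) ^ N * inverse ((e2pi (1 / 2) \<tau> * e2pi 1 u) ^ N) * appell_lerch N z u \<tau>"
proof -
  have "(\<Sum>\<^sub>\<infinity>n. appell_term N z \<tau> n (u + \<tau>)) =
      (- 1) ^ N * inverse (e2pi (of_nat N) (u + \<tau>)) * (\<Sum>\<^sub>\<infinity>n. appell_term N z \<tau> (n + 1) u)"
    unfolding appell_term_add_tau by (rule infsum_cmult_right')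
  also have "(\<Sum>\<^sub>\<infinity>n. appell_term N z \<tau> (n + 1) u) = (\<Sum>\<^sub>\<infinity>n. appell_term N z \<tau> n u)"
  proof (rule infsum_reindex_bij_betw)
    show "bij (\<lambda>n::int. n + 1)" by (rule bij_plus_right)
  qed
  finally have "appell_lerch N z (u + \<tau>) \<tau> =
      e2pi (of_nat N / 2) \<tau> * inverse (e2pi (of_nat N) (u + \<tau>)) * ((- 1) ^ N * appell_lerch N z u \<tau>)"
    by (simp add: appell_lerch_eq e2pi_add_right)
  also have "e2pi (of_nat N / 2) \<tau> * inverse (e2pi (of_nat N) (u + \<tau>)) = inverse ((e2pi (1 / 2) \<tau> * e2pi 1 u) ^ N)"
  proof -
    have "e2pi (of_nat N) \<tau> = e2pi (of_nat N / 2) \<tau> * e2pi (of_nat N / 2) \<tau>"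
      by (simp add: e2pi_add_left[symmetric])
    then show ?thesis
      by (simp add: power_mult_distrib e2pi_power e2pi_add_right)
  qed
  finally show ?thesis by simp
qed

text \<open>
  Only the term of index \<open>0\<close> is singular at \<open>u = - z\<close>, since \<open>n \<tau>\<close> is not real for
  \<open>n \<noteq> 0\<close>. That term is \<open>1 / (1 - \<zeta> w)\<close>, and the prefactor \<open>(\<zeta> w)^(N / 2)\<close> equals
  \<open>1\<close> there.
\<close>

lemma appell_lerch_pole:
  assumes "N \<ge> 1" "Im \<tau> > 0"
  shows "((\<lambda>u. appell_lerch N z u \<tau> * (u - (- z))) \<longlongrightarrow> - 1 / (2 * of_real pi * \<i>)) (at (- z))"
proof -
  define r where "r = (\<lambda>u. \<Sum>\<^sub>\<infinity>n\<in>UNIV - {0}. appell_term N z \<tau> n u)"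
  have "r field_differentiable at (- z)"
    unfolding r_def
  proof (rule appell_sum(2)[OF assms])
    fix n :: int assume "n \<in> UNIV - {0}"
    then have "Im (z + - z + of_int n * \<tau>) \<noteq> 0" using assms(2) by simp
    then show "z + - z + of_int n * \<tau> \<notin> \<int>" by (metis Ints_cases complex_Im_of_int)
  qed
  then have r: "(r \<longlongrightarrow> r (- z)) (at (- z))"
    using field_differentiable_imp_continuous_at isCont_def by blast
  have split: "(\<Sum>\<^sub>\<infinity>n. appell_term N z \<tau> n u) = 1 / (1 - e2pi 1 (u - (- z))) + r u" for u
  proof -
    have "(\<Sum>\<^sub>\<infinity>n\<in>{0} \<union> (UNIV - {0}). appell_term N z \<tau> n u) =
        (\<Sum>\<^sub>\<infinity>n\<in>{0}. appell_term N z \<tau> n u) + r u"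
      unfolding r_def by (rule infsum_Un_disjoint) (auto intro: appell_sum(1)[OF assms])
    then show ?thesis
      by (simp add: appell_term_def e2pi_add_right mult.commute)
  qed
  have "((\<lambda>x. (e2pi 1 (0 + x) - e2pi 1 0) / x) \<longlongrightarrow> 2 * of_real pi * \<i>) (at 0)"
    using e2pi_has_field_derivative[of 1 0] unfolding DERIV_def by simp
  then have "((\<lambda>x. - inverse ((e2pi 1 x - 1) / x)) \<longlongrightarrow> - inverse (2 * of_real pi * \<i>)) (at 0)"
    by (intro tendsto_intros) auto
  then have "((\<lambda>x. x / (1 - e2pi 1 x)) \<longlongrightarrow> - inverse (2 * of_real pi * \<i>)) (at 0)"
  proof -
    have "(\<lambda>x. - inverse ((e2pi 1 x - 1) / x)) = (\<lambda>x. x / (1 - e2pi 1 x))"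
      by (metis inverse_divide minus_diff_eq minus_divide_right)
    then show ?thesis
      using \<open>((\<lambda>x. - inverse ((e2pi 1 x - 1) / x)) \<longlongrightarrow> _) (at 0)\<close> by simp
  qed
  then have main: "((\<lambda>u. (u - (- z)) / (1 - e2pi 1 (u - (- z)))) \<longlongrightarrow> - inverse (2 * of_real pi * \<i>)) (at (- z))"
    by (subst at_to_0) (simp add: filterlim_filtermap)
  have pref: "((\<lambda>u. e2pi (of_nat N / 2) z * e2pi (of_nat N / 2) u) \<longlongrightarrow> 1) (at (- z))"
  proof -
    have "isCont (\<lambda>u. e2pi (of_nat N / 2) z * e2pi (of_nat N / 2) u) (- z)"
      unfolding e2pi_def by (intro continuous_intros)
    then show ?thesis by (simp add: isCont_def e2pi_uminus_right)
  qed
  have "((\<lambda>u. e2pi (of_nat N / 2) z * e2pi (of_nat N / 2) u *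
      ((u - (- z)) / (1 - e2pi 1 (u - (- z))) + (u - (- z)) * r u))
      \<longlongrightarrow> 1 * (- inverse (2 * of_real pi * \<i>) + (- z - (- z)) * r (- z))) (at (- z))"
    by (intro tendsto_mult tendsto_add pref main r tendsto_diff tendsto_ident_at tendsto_const)
  moreover have "1 * (- inverse (2 * of_real pi * \<i>) + (- z - (- z)) * r (- z)) = - 1 / (2 * of_real pi * \<i>)"
    by (simp add: inverse_eq_divide)
  moreover have "p * (1 / d + s) * x = p * (x / d + x * s)" for p d s x :: complex
    by (simp add: algebra_simps)
  ultimately show ?thesis
    unfolding appell_lerch_eq split by (simp only:)
qed

section \<open>The two residues and the identity\<close>

text \<open>
  The Cauchy product involves the exact orders of both series; replacing them by the bound
  \<open>K\<close> on the pole order only adds or removes zero terms.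
\<close>

lemma fls_residue_times_fps:
  fixes L :: "'a :: field fls"
  assumes "\<And>n. n < - int K \<Longrightarrow> fls_nth L n = 0"
  shows "fls_residue (L * fps_to_fls G) = (\<Sum>k=1..K. fls_nth L (- int k) * fps_nth G (k - 1))"
proof -
  define f where "f = (\<lambda>i. fls_nth L i * fls_nth (fps_to_fls G) (- 1 - i))"
  let ?A = "{fls_subdegree L..- 1 - fls_subdegree (fps_to_fls G)}"
  let ?B = "{- int K..- 1}"
  have "fls_residue (L * fps_to_fls G) = sum f ?A"
    unfolding f_def fls_residue_def by (rule fls_times_nth(2))
  also have "\<dots> = sum f (?A \<inter> ?B)"
    by (rule sum.mono_neutral_right) (auto simp: f_def assms not_le)
  also have "\<dots> = sum f ?B"
  proof (rule sum.mono_neutral_left)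
    have "f i = 0" if "i \<notin> ?A" for i
    proof -
      have "i < fls_subdegree L \<or> - 1 - i < fls_subdegree (fps_to_fls G)" using that by auto
      then show ?thesis
        unfolding f_def by (metis fls_eq0_below_subdegree mult_zero_left mult_zero_right)
    qed
    then show "\<forall>i\<in>?B - ?A \<inter> ?B. f i = 0" by blast
  qed auto
  also have "\<dots> = (\<Sum>k=1..K. f (- int k))"
    by (rule sum.reindex_bij_witness[of _ "\<lambda>k. - int k" "\<lambda>i. nat (- i)"]) auto
  also have "\<dots> = (\<Sum>k=1..K. fls_nth L (- int k) * fps_nth G (k - 1))"
    by (rule sum.cong) (auto simp: f_def nat_diff_distrib)
  finally show ?thesis .
qed

text \<open>
  An open set of holomorphy is needed, and not just the point \<open>u\<close>, since each step
  differentiates an identity of functions.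
\<close>

lemma D_w_funpow:
  assumes "f holomorphic_on S" "open S" "u \<in> S"
  shows "(D_w ^^ n) f u = (deriv ^^ n) f u / (2 * of_real pi * \<i>) ^ n"
  using assms(3)
proof (induction n arbitrary: u)
  case (Suc n)
  have "(deriv ^^ n) f field_differentiable at u"
    using assms Suc.prems by (intro holomorphic_on_imp_differentiable_at[of _ S] holomorphic_higher_deriv)
  then have "((deriv ^^ n) f has_field_derivative (deriv ^^ Suc n) f u) (at u)"
    by (simp add: DERIV_deriv_iff_field_differentiable)
  then have "((\<lambda>v. (deriv ^^ n) f v / (2 * of_real pi * \<i>) ^ n) has_field_derivative
      (deriv ^^ Suc n) f u / (2 * of_real pi * \<i>) ^ n) (at u)"
    by (rule DERIV_cdivide)
  then have "((D_w ^^ n) f has_field_derivative (deriv ^^ Suc n) f u / (2 * of_real pi * \<i>) ^ n) (at u)"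
    by (rule has_field_derivative_transform_within_open[OF _ assms(2) Suc.prems]) (simp add: Suc.IH)
  then have "deriv ((D_w ^^ n) f) u = (deriv ^^ Suc n) f u / (2 * of_real pi * \<i>) ^ n"
    by (rule DERIV_imp_deriv)
  moreover have "D_w g u = deriv g u / (2 * of_real pi * \<i>)" for g
    by (simp add: D_w_def)
  ultimately show ?case by simp
qed simp

text \<open>
  The indices \<open>k\<close> with the parity of \<open>N\<close> in the range \<open>1, ..., N + 2 M\<close> are exactly the
  \<open>2 j + \<delta> + 1\<close>, because \<open>\<delta> + 1\<close> is the smallest positive integer of that parity.
\<close>

lemma sum_parity_reindex:
  fixes f :: "nat \<Rightarrow> 'a :: comm_monoid_add"
  assumes "N \<ge> 1" and zero: "\<And>k. even k \<noteq> even N \<Longrightarrow> f k = 0"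
  shows "(\<Sum>k=1..N + 2 * M. f k) =
    (\<Sum>j=0..(N - 1 - delta_e N) div 2 + M. f (2 * j + delta_e N + 1))"
proof -
  let ?J = "{0..(N - 1 - delta_e N) div 2 + M}"
  let ?g = "\<lambda>j. 2 * j + delta_e N + 1"
  have d: "even (N - 1 - delta_e N)" "delta_e N + 1 \<le> N" "delta_e N \<le> 1" "even (delta_e N + 1) = even N"
    using assms(1) by (auto simp: delta_e_def elim!: evenE oddE)
  have "(\<Sum>k=1..N + 2 * M. f k) = sum f (?g ` ?J)"
  proof (rule sum.mono_neutral_right)
    show "?g ` ?J \<subseteq> {1..N + 2 * M}" using d by auto
    show "\<forall>k\<in>{1..N + 2 * M} - ?g ` ?J. f k = 0"
    proof (intro ballI zero notI)
      fix k assume k: "k \<in> {1..N + 2 * M} - ?g ` ?J" "even k = even N"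
      have "delta_e N + 1 \<le> k" using k d(3) by (auto simp: delta_e_def split: if_splits elim!: evenE)
      moreover have "even (k - (delta_e N + 1))" using k(2) d(4) calculation by simp
      ultimately obtain j where j: "k = 2 * j + delta_e N + 1"
        by (metis evenE add.assoc le_add_diff_inverse2)
      then have "j \<in> ?J" using k(1) d(1,2) by (auto elim!: evenE)
      with j k(1) show False by blast
    qed
  qed simp
  also have "\<dots> = (\<Sum>j\<in>?J. f (?g j))"
    by (subst sum.reindex) (auto simp: inj_on_def)
  finally show ?thesis .
qed

lemma residue_phi_appell_at_pole:
  assumes "N \<ge> 1" "Im \<tau> > 0" "z \<notin> period_lattice \<tau>"
  shows "residue (\<lambda>u. phi (2 * M) (N + 2 * M) u \<tau> * appell_lerch N z u \<tau>) (- z) =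
    - ((- 1) ^ N * phi (2 * M) (N + 2 * M) z \<tau>) / (2 * of_real pi * \<i>)"
proof (rule residue_simple')
  let ?\<phi> = "\<lambda>u. phi (2 * M) (N + 2 * M) u \<tau>"
  \<comment> \<open>the radius excludes every other lattice translate of \<open>- z\<close>\<close>
  define S where "S = - period_lattice \<tau> \<inter> ball (- z) (min 1 (Im \<tau>))"
  have opL: "open (- period_lattice \<tau>)" using closed_period_lattice[OF assms(2)] by auto
  show "open S" "- z \<in> S" unfolding S_def using opL assms by auto
  have "u + z \<notin> period_lattice \<tau>" if "u \<in> S - {- z}" for u
  proof
    assume "u + z \<in> period_lattice \<tau>"
    then have "u + z = 0"
    proof (rule period_lattice_eq_0)
      have "norm (u + z) < min 1 (Im \<tau>)"
        using that by (simp add: S_def dist_norm norm_minus_commute add.commute del: min_less_iff_conj)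
      then show "\<bar>Re (u + z)\<bar> < 1" "\<bar>Im (u + z)\<bar> < Im \<tau>"
        using abs_Re_le_cmod[of "u + z"] abs_Im_le_cmod[of "u + z"] by linarith+
    qed
    with that show False by (simp add: eq_neg_iff_add_eq_0)
  qed
  then show "(\<lambda>u. ?\<phi> u * appell_lerch N z u \<tau>) holomorphic_on S - {- z}"
    by (intro holomorphic_on_mult holomorphic_on_subset[OF holomorphic_on_phi[OF assms(2)]]
          holomorphic_on_subset[OF holomorphic_on_appell_lerch[OF assms(1,2)]]) (auto simp: S_def)
  have "isCont ?\<phi> (- z)"
    using holomorphic_on_imp_continuous_on[OF holomorphic_on_phi[OF assms(2)]] assms(3)
    unfolding continuous_on_eq_continuous_at[OF opL] by simp
  then have "(?\<phi> \<longlongrightarrow> ?\<phi> (- z)) (at (- z))" by (simp add: isCont_def)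
  from tendsto_mult[OF this appell_lerch_pole[OF assms(1,2), of z]]
  show "((\<lambda>u. ?\<phi> u * appell_lerch N z u \<tau> * (u - - z)) \<longlongrightarrow>
      - ((- 1) ^ N * phi (2 * M) (N + 2 * M) z \<tau>) / (2 * of_real pi * \<i>)) (at (- z))"
    by (simp add: mult.assoc phi_uminus[OF assms(2)])
qed

lemma residue_phi_appell_at_0:
  assumes "N \<ge> 1" "Im \<tau> > 0" "z \<notin> period_lattice \<tau>"
  shows "2 * of_real pi * \<i> * residue (\<lambda>u. phi (2 * M) (N + 2 * M) u \<tau> * appell_lerch N z u \<tau>) 0 =
    (\<Sum>j = 0..(N - 1 - delta_e N) div 2 + M.
       laurent_D (2 * M) (N + 2 * M) (2 * j + delta_e N + 1) \<tau> / fact (2 * j + delta_e N)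
       * (D_w ^^ (2 * j + delta_e N)) (\<lambda>u. appell_lerch N z u \<tau>) 0)"
proof -
  define c :: complex where "c = 2 * of_real pi * \<i>"
  have c: "c \<noteq> 0" by (simp add: c_def)
  let ?F = "\<lambda>u. appell_lerch N z u \<tau>"
  define S where "S = {u. u + z \<notin> period_lattice \<tau>}"
  have S: "?F holomorphic_on S" "open S" "0 \<in> S"
    unfolding S_def using assms
    by (auto intro: holomorphic_on_appell_lerch open_shifted_period_lattice_complement)
  obtain L where L: "(\<lambda>u. phi (2 * M) (N + 2 * M) u \<tau>) has_laurent_expansion L"
    and low: "\<And>n. n < - int (N + 2 * M) \<Longrightarrow> fls_nth L n = 0"
    and parity: "\<And>n. even n \<noteq> even N \<Longrightarrow> fls_nth L n = 0"
    using has_laurent_expansion_phi[OF assms(2), of M N] by blast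
  define G where "G = fps_expansion ?F 0"
  have "?F has_fps_expansion G"
    unfolding G_def using S by (intro analytic_at_imp_has_fps_expansion_0) (auto simp: analytic_at)
  then have "residue (\<lambda>u. phi (2 * M) (N + 2 * M) u \<tau> * ?F u) 0 = fls_residue (L * fps_to_fls G)"
    by (intro has_laurent_expansion_residue_0 laurent_expansion_intros has_laurent_expansion_fps L)
  also have "\<dots> = (\<Sum>k=1..N + 2 * M. fls_nth L (- int k) * fps_nth G (k - 1))"
    by (rule fls_residue_times_fps[OF low])
  also have "\<dots> = (\<Sum>j = 0..(N - 1 - delta_e N) div 2 + M.
      fls_nth L (- int (2 * j + delta_e N + 1)) * fps_nth G (2 * j + delta_e N + 1 - 1))"
    by (rule sum_parity_reindex[OF assms(1)]) (simp add: parity)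
  finally have res: "residue (\<lambda>u. phi (2 * M) (N + 2 * M) u \<tau> * ?F u) 0 =
    (\<Sum>j = 0..(N - 1 - delta_e N) div 2 + M.
      fls_nth L (- int (2 * j + delta_e N + 1)) * fps_nth G (2 * j + delta_e N + 1 - 1))" .
  have "c * residue (\<lambda>u. phi (2 * M) (N + 2 * M) u \<tau> * ?F u) 0 = (\<Sum>j = 0..(N - 1 - delta_e N) div 2 + M.
       laurent_D (2 * M) (N + 2 * M) (2 * j + delta_e N + 1) \<tau> / fact (2 * j + delta_e N)
       * (D_w ^^ (2 * j + delta_e N)) ?F 0)"
    unfolding res sum_distrib_left
  proof (rule sum.cong)
    fix j
    define k where "k = 2 * j + delta_e N"
    have "laurent_D (2 * M) (N + 2 * M) (k + 1) \<tau> = c ^ (k + 1) * fls_nth L (- int (k + 1))"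
      by (simp add: laurent_D_def c_def laurent_expansion_0_eqI[OF L])
    moreover have "(D_w ^^ k) ?F 0 = (deriv ^^ k) ?F 0 / c ^ k"
      using D_w_funpow[OF S] by (simp add: c_def)
    ultimately show "c * (fls_nth L (- int (2 * j + delta_e N + 1)) * fps_nth G (2 * j + delta_e N + 1 - 1)) =
       laurent_D (2 * M) (N + 2 * M) (2 * j + delta_e N + 1) \<tau> / fact (2 * j + delta_e N)
       * (D_w ^^ (2 * j + delta_e N)) ?F 0"
      using c unfolding k_def[symmetric] by (simp add: G_def fps_expansion_def)
  qed simp
  then show ?thesis unfolding c_def .
qed

text \<open>
  It remains to see that the product is elliptic: the signs \<open>(-1)^N\<close> and the powers of
  \<open>q^(1/2) w\<close> that its two factors pick up are mutually inverse.
\<close>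

theorem theorem1p3:
  fixes N M :: nat and \<tau> z :: complex
  assumes "N \<ge> 1"
    and "Im \<tau> > 0"
    and "z \<notin> period_lattice \<tau>"
  shows "phi (2 * M) (N + 2 * M) z \<tau> =
    (- 1) ^ (1 + delta_e N) *
    (\<Sum>j = 0..(N - 1 - delta_e N) div 2 + M.
       laurent_D (2 * M) (N + 2 * M) (2 * j + delta_e N + 1) \<tau> / fact (2 * j + delta_e N)
       * (D_w ^^ (2 * j + delta_e N)) (\<lambda>u. appell_lerch N z u \<tau>) 0)"
proof -
  define h where "h = (\<lambda>u. phi (2 * M) (N + 2 * M) u \<tau> * appell_lerch N z u \<tau>)"
  have "residue h 0 + residue h (- z) = 0"
  proof (rule elliptic_two_residues[OF assms(2)])
    show "- z \<notin> period_lattice \<tau>" using assms(3) by simp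
    show "h holomorphic_on {u. u \<notin> period_lattice \<tau> \<and> u - - z \<notin> period_lattice \<tau>}"
      unfolding h_def
      by (intro holomorphic_on_mult holomorphic_on_subset[OF holomorphic_on_phi[OF assms(2)]]
          holomorphic_on_subset[OF holomorphic_on_appell_lerch[OF assms(1,2)]]) auto
    show "h (u + 1) = h u" for u
      by (simp add: h_def phi_add_1 appell_lerch_add_1 flip: power_add)
    show "h (u + \<tau>) = h u" for u
    proof -
      define a where "a = (e2pi (1 / 2) \<tau> * e2pi 1 u) ^ N"
      have "a \<noteq> 0" by (simp add: a_def)
      then show ?thesis
        unfolding h_def phi_add_tau[OF assms(2)] appell_lerch_add_tau a_def[symmetric]
        by (cases "even N") simp_all
    qed
  qed
  then have "(- 1) ^ N * phi (2 * M) (N + 2 * M) z \<tau> = 2 * of_real pi * \<i> * residue h 0"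
    unfolding h_def residue_phi_appell_at_pole[OF assms] by (simp add: field_simps)
  then have "phi (2 * M) (N + 2 * M) z \<tau> = (- 1) ^ N * (2 * of_real pi * \<i> * residue h 0)"
    by (metis left_minus_one_mult_self)
  moreover have "(- 1 :: complex) ^ N = (- 1) ^ (1 + delta_e N)"
    by (simp add: delta_e_def)
  ultimately show ?thesis
    unfolding h_def residue_phi_appell_at_0[OF assms] by simp
qed

end
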